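(* Let $X$ be any set. A function $f:2^{X_d}_f\to 2^{X_d}_f$ is a homeomorphism if and only if there exists a bijection $\gamma:X\to X$ such that $f=2^{\gamma}$, where $2^\gamma(C)=\gamma(C)$ is the image of $C$ under $\gamma$. That is, the group of self-homeomorphisms of $2^{X_d}_f$ is isomorphic to the group of permutations of $\operatorname{card}(X)$ elements.
   Context: For a set $X$, let $X_d$ be $X$ with the discrete topology. $2^{X_d}_u$ denotes the set of all non-empty subsets of $X$ with the upper semifinite topology, i.e. the topology generated by the base of sets $B(U)=\{C\subseteq X: C\neq\emptyset,\ C\subseteq U\}$, $U\subseteq X$. $2^{X_d}_f\subset 2^{X_d}_u$ is the subspace of finite non-empty subsets of $X$, with the subspace topology. *)

theory Defs
  imports "HOL-Analysis.Abstract_Topology" "HOL-Algebra.Bij"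
begin

definition upper_box :: "'a set \<Rightarrow> 'a set set"
  where "upper_box U = {C. C \<noteq> {} \<and> C \<subseteq> U}"

definition upper_semifinite_discrete :: "'a set \<Rightarrow> 'a set topology"
  where "upper_semifinite_discrete X = topology_generated_by {upper_box U | U. U \<subseteq> X}"

definition finite_hyperspace :: "'a set \<Rightarrow> 'a set topology"
  where "finite_hyperspace X =
    subtopology (upper_semifinite_discrete X) {C. C \<subseteq> X \<and> C \<noteq> {} \<and> finite C}"

text \<open>As in \<^const>\<open>BijGroup\<close>, homeomorphisms are taken to be extensional, so that functions
  that agree on the underlying space are identified; the operation is composition.\<close>

definition HomeoGroup :: "'a topology \<Rightarrow> ('a \<Rightarrow> 'a) monoid"
  where "HomeoGroup T = BijGroup (topspace T)
    \<lparr>carrier := {f \<in> extensional (topspace T). homeomorphic_map T T f}\<rparr>"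

lemma topspace_upper_semifinite_discrete:
  "topspace (upper_semifinite_discrete X) = {C. C \<subseteq> X \<and> C \<noteq> {}}"
  by (auto simp: upper_semifinite_discrete_def upper_box_def)

lemma topspace_finite_hyperspace:
  "topspace (finite_hyperspace X) = {C. C \<subseteq> X \<and> C \<noteq> {} \<and> finite C}"
  by (auto simp: finite_hyperspace_def topspace_upper_semifinite_discrete)

lemma openin_upper_semifinite_discrete:
  "openin (upper_semifinite_discrete X) W \<longleftrightarrow>
    (\<exists>\<U>. \<U> \<subseteq> {upper_box U | U. U \<subseteq> X} \<and> W = \<Union>\<U>)" (is "?L \<longleftrightarrow> ?R")
proof
  assume L: ?L
  have "generate_topology_on {upper_box U | U. U \<subseteq> X} W"
    using L unfolding upper_semifinite_discrete_def by (rule openin_topology_generated_by)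
  then have up: "D \<in> W" if "C \<in> W" "D \<noteq> {}" "D \<subseteq> C" for C D
    using that
  proof (induction arbitrary: C D)
    case (Basis s)
    then obtain U where "s = upper_box U" by auto
    then show ?case using Basis.prems by (auto simp: upper_box_def)
  next
    case (UN K)
    then obtain k where "k \<in> K" "C \<in> k" by auto
    then show ?case using UN.IH [of k C D] UN.prems by blast
  next
    case Empty
    from Empty.prems(1) show ?case by blast
  next
    case (Int a b)
    from Int.prems(1) have "C \<in> a" "C \<in> b" by blast+
    then show ?case
      using Int.IH(1) [OF _ Int.prems(2,3)] Int.IH(2) [OF _ Int.prems(2,3)] by (intro IntI)
  qed
  have sub: "C \<subseteq> X" "C \<noteq> {}" if "C \<in> W" for C
    using openin_subset [OF L] that by (auto simp: topspace_upper_semifinite_discrete)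
  have "W = \<Union>(upper_box ` W)"
  proof (intro equalityI subsetI)
    fix C assume "C \<in> W"
    then show "C \<in> \<Union>(upper_box ` W)"
      using sub by (auto simp: upper_box_def intro!: bexI [of _ C])
  next
    fix D assume "D \<in> \<Union>(upper_box ` W)"
    then obtain C where "C \<in> W" "D \<noteq> {}" "D \<subseteq> C"
      by (auto simp: upper_box_def)
    then show "D \<in> W" by (rule up)
  qed
  moreover have "upper_box ` W \<subseteq> {upper_box U | U. U \<subseteq> X}"
    using sub(1) by auto
  ultimately show ?R by (intro exI [of _ "upper_box ` W"] conjI)
next
  assume ?R
  then obtain \<U> where \<U>: "\<U> \<subseteq> {upper_box U | U. U \<subseteq> X}" "W = \<Union>\<U>" by auto
  have "openin (upper_semifinite_discrete X) V" if "V \<in> \<U>" for V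
    unfolding upper_semifinite_discrete_def
    by (rule topology_generated_by_Basis) (use \<U>(1) that in auto)
  then show ?L unfolding \<U>(2) by (rule openin_Union)
qed

lemma group_HomeoGroup: "group (HomeoGroup T)"
proof -
  let ?S = "topspace T"
  interpret B: group "BijGroup ?S" by (rule group_BijGroup)
  have sub: "{f \<in> extensional ?S. homeomorphic_map T T f} \<subseteq> Bij ?S"
    by (auto simp: Bij_def bij_betw_def homeomorphic_eq_everything_map)
  have "subgroup {f \<in> extensional ?S. homeomorphic_map T T f} (BijGroup ?S)"
  proof (rule B.subgroupI)
    show "{f \<in> extensional ?S. homeomorphic_map T T f} \<subseteq> carrier (BijGroup ?S)"
      using sub by (simp add: BijGroup_def)
    have "homeomorphic_map T T (\<lambda>x\<in>?S. x)"
      by (rule homeomorphic_map_eq [where f = id]) auto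
    then show "{f \<in> extensional ?S. homeomorphic_map T T f} \<noteq> {}"
      using restrict_extensional by blast
  next
    fix f assume f: "f \<in> {f \<in> extensional ?S. homeomorphic_map T T f}"
    then have fB: "f \<in> Bij ?S" using sub by blast
    from f obtain g where g: "homeomorphic_maps T T f g"
      by (auto simp: homeomorphic_map_maps)
    then have hg: "homeomorphic_map T T g"
      by (simp add: homeomorphic_maps_map)
    have "inv_into ?S f y = g y" if "y \<in> ?S" for y
    proof -
      have "g y \<in> ?S" "f (g y) = y"
        using g that by (auto simp: homeomorphic_maps_def continuous_map_def)
      then show ?thesis
        using fB by (auto simp: Bij_def bij_betw_def intro: inv_into_f_eq)
    qed
    then have "homeomorphic_map T T (\<lambda>y\<in>?S. inv_into ?S f y)"
      by (intro homeomorphic_map_eq [OF hg]) auto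
    then show "inv\<^bsub>BijGroup ?S\<^esub> f \<in> {f \<in> extensional ?S. homeomorphic_map T T f}"
      using fB by (simp add: inv_BijGroup)
  next
    fix f g
    assume f: "f \<in> {f \<in> extensional ?S. homeomorphic_map T T f}"
      and g: "g \<in> {f \<in> extensional ?S. homeomorphic_map T T f}"
    then have "homeomorphic_map T T (f \<circ> g)"
      using homeomorphic_map_compose by blast
    then have "homeomorphic_map T T (compose ?S f g)"
      by (rule homeomorphic_map_eq) (simp add: compose_def)
    then show "f \<otimes>\<^bsub>BijGroup ?S\<^esub> g \<in> {f \<in> extensional ?S. homeomorphic_map T T f}"
      using f g sub by (auto simp: BijGroup_def subset_iff)
  qed
  then show ?thesis
    unfolding HomeoGroup_def by (rule B.subgroup_imp_group)
qed

end

theory Submission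
  imports Defs
begin

text \<open>
  The topology of the finite hyperspace is nothing but its inclusion order: the open sets are
  the families of finite non-empty sets that are closed under passing to non-empty subsets
  (\<open>openin_finite_hyperspace_iff\<close>), hence continuity is monotonicity and a homeomorphism is an
  isomorphism of inclusion orders (\<open>homeomorphic_map_finite_hyperspace_iff_order\<close>).

  The order remembers the points, because the singletons are its minimal elements. An order
  isomorphism \<open>f\<close> therefore sends singletons to singletons, which defines \<open>\<gamma>\<close> by
  \<open>f {x} = {\<gamma> x}\<close>; and a set is determined by the singletons below it, so \<open>f\<close> takes every
  set to its image under \<open>\<gamma>\<close> (\<open>order_iso_imp_image\<close>). Conversely, the image map of a bijection
  is an order isomorphism.

  The same recovery of \<open>\<gamma>\<close> from singletons makes \<open>\<gamma> \<mapsto> 2\<^sup>\<gamma>\<close> injective on extensional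
  bijections, and images respect composition, so this map is the isomorphism of groups.
\<close>

definition finite_subsets :: "'a set \<Rightarrow> 'a set set"
  where "finite_subsets X = {C. C \<subseteq> X \<and> C \<noteq> {} \<and> finite C}"

lemma topspace_eq_finite_subsets: "topspace (finite_hyperspace X) = finite_subsets X"
  by (simp add: topspace_finite_hyperspace finite_subsets_def)

lemma singleton_in_finite_subsets [simp]: "{x} \<in> finite_subsets X \<longleftrightarrow> x \<in> X"
  by (simp add: finite_subsets_def)

lemma bij_betw_image_finite_subsets:
  assumes "bij_betw \<gamma> X Y"
  shows "bij_betw ((`) \<gamma>) (finite_subsets X) (finite_subsets Y)"
proof (rule bij_betw_imageI)
  have inj: "inj_on \<gamma> X" and img: "\<gamma> ` X = Y"
    using assms by (auto simp: bij_betw_def)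
  show "inj_on ((`) \<gamma>) (finite_subsets X)"
    using inj by (auto simp: finite_subsets_def inj_on_def inj_on_image_eq_iff)
  show "(`) \<gamma> ` finite_subsets X = finite_subsets Y"
  proof (intro equalityI subsetI)
    fix D assume "D \<in> finite_subsets Y"
    then obtain C where "C \<subseteq> X" "finite C" "D = \<gamma> ` C" "D \<noteq> {}"
      unfolding finite_subsets_def using img by (auto dest: finite_subset_image)
    then show "D \<in> (`) \<gamma> ` finite_subsets X"
      by (auto simp: finite_subsets_def)
  qed (use img in \<open>auto simp: finite_subsets_def\<close>)
qed

section \<open>The topology as an order\<close>

text \<open>A union of boxes is closed under non-empty subsets; conversely a family closed in this way
  is the union of the boxes of its members. The topology is thus the Alexandrov topology of
  reverse inclusion.\<close>

lemma openin_finite_hyperspace_iff: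
  "openin (finite_hyperspace X) W \<longleftrightarrow>
    W \<subseteq> finite_subsets X \<and> (\<forall>C\<in>W. \<forall>D. D \<noteq> {} \<and> D \<subseteq> C \<longrightarrow> D \<in> W)"
    (is "?L \<longleftrightarrow> ?R")
proof
  assume ?L
  then obtain V where V: "openin (upper_semifinite_discrete X) V"
    and W: "W = V \<inter> finite_subsets X"
    by (auto simp: finite_hyperspace_def openin_subtopology finite_subsets_def)
  obtain \<U> where U: "\<U> \<subseteq> {upper_box U | U. U \<subseteq> X}" "V = \<Union>\<U>"
    using V by (auto simp: openin_upper_semifinite_discrete)
  have "D \<in> W" if C: "C \<in> W" and D: "D \<noteq> {}" "D \<subseteq> C" for C D
  proof -
    have "D \<in> finite_subsets X"
      using C D W by (auto simp: finite_subsets_def intro: finite_subset)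
    moreover obtain U where "upper_box U \<in> \<U>" "C \<in> upper_box U"
      using C W U by blast
    then have "upper_box U \<in> \<U>" "D \<in> upper_box U"
      using D by (auto simp: upper_box_def)
    then have "D \<in> V" using U(2) by blast
    ultimately show ?thesis using W by blast
  qed
  then show ?R using W by blast
next
  assume R: ?R
  define V where "V = \<Union>(upper_box ` W)"
  have "openin (upper_semifinite_discrete X) V"
    unfolding openin_upper_semifinite_discrete V_def
    using R by (intro exI [of _ "upper_box ` W"]) (auto simp: finite_subsets_def)
  moreover have "W = V \<inter> finite_subsets X"
    using R by (auto simp: V_def upper_box_def finite_subsets_def)
  ultimately show ?L
    by (auto simp: finite_hyperspace_def openin_subtopology finite_subsets_def)
qed

text \<open>The sets below \<open>f C\<close> form the smallest open neighbourhood of \<open>f C\<close>, so continuity only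
  has to be tested on these neighbourhoods.\<close>

lemma continuous_map_finite_hyperspace_iff:
  "continuous_map (finite_hyperspace X) (finite_hyperspace Y) f \<longleftrightarrow>
    f \<in> finite_subsets X \<rightarrow> finite_subsets Y \<and> mono_on (finite_subsets X) f"
    (is "?L \<longleftrightarrow> ?R")
proof
  assume L: ?L
  then have f: "f \<in> finite_subsets X \<rightarrow> finite_subsets Y"
    by (auto simp: continuous_map_def topspace_eq_finite_subsets)
  have "f D \<subseteq> f C" if C: "C \<in> finite_subsets X" and D: "D \<in> finite_subsets X" "D \<subseteq> C" for C D
  proof -
    let ?V = "{E \<in> finite_subsets Y. E \<subseteq> f C}"
    have "openin (finite_hyperspace Y) ?V"
      by (auto simp: openin_finite_hyperspace_iff finite_subsets_def intro: finite_subset)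
    then have "openin (finite_hyperspace X) {E \<in> finite_subsets X. f E \<in> ?V}"
      using L by (auto simp: continuous_map_def topspace_eq_finite_subsets)
    moreover have "C \<in> {E \<in> finite_subsets X. f E \<in> ?V}"
      using C f by auto
    moreover have "D \<noteq> {}"
      using D by (simp add: finite_subsets_def)
    ultimately have "D \<in> {E \<in> finite_subsets X. f E \<in> ?V}"
      using D(2) unfolding openin_finite_hyperspace_iff by blast
    then show ?thesis by simp
  qed
  then have "mono_on (finite_subsets X) f"
    by (intro mono_onI)
  then show ?R using f by blast
next
  assume R: ?R
  have "openin (finite_hyperspace X) {E \<in> finite_subsets X. f E \<in> W}"
    if W: "openin (finite_hyperspace Y) W" for W
    unfolding openin_finite_hyperspace_iff
  proof (intro conjI ballI allI impI)
    fix C D assume C: "C \<in> {E \<in> finite_subsets X. f E \<in> W}" and D: "D \<noteq> {} \<and> D \<subseteq> C"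
    then have DX: "D \<in> finite_subsets X"
      by (auto simp: finite_subsets_def intro: finite_subset)
    have "f D \<subseteq> f C"
      using R C D DX by (auto dest: mono_onD)
    moreover have "f D \<noteq> {}"
      using R DX by (auto simp: finite_subsets_def)
    ultimately have "f D \<in> W"
      using W C unfolding openin_finite_hyperspace_iff by blast
    then show "D \<in> {E \<in> finite_subsets X. f E \<in> W}" using DX by blast
  qed blast
  then show ?L
    using R by (auto simp: continuous_map_def topspace_eq_finite_subsets)
qed

lemma homeomorphic_map_finite_hyperspace_iff_order:
  "homeomorphic_map (finite_hyperspace X) (finite_hyperspace Y) f \<longleftrightarrow>
    bij_betw f (finite_subsets X) (finite_subsets Y) \<and>
    (\<forall>C\<in>finite_subsets X. \<forall>D\<in>finite_subsets X. f C \<subseteq> f D \<longleftrightarrow> C \<subseteq> D)"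
    (is "?L \<longleftrightarrow> ?R")
proof
  assume L: ?L
  then obtain g where g: "homeomorphic_maps (finite_hyperspace X) (finite_hyperspace Y) f g"
    by (auto simp: homeomorphic_map_maps)
  \<comment> \<open>Being injective and monotone would not make \<open>f\<close> reflect the order; this takes the
    monotonicity of its inverse.\<close>
  then have f_mono: "mono_on (finite_subsets X) f" and g_mono: "mono_on (finite_subsets Y) g"
    and gf: "g (f C) = C" if "C \<in> finite_subsets X" for C
    using that
    by (auto simp: homeomorphic_maps_def continuous_map_finite_hyperspace_iff
        topspace_eq_finite_subsets)
  have bij: "bij_betw f (finite_subsets X) (finite_subsets Y)"
    using L
    by (auto simp: homeomorphic_eq_everything_map bij_betw_def topspace_eq_finite_subsets)
  moreover have "f C \<subseteq> f D \<longleftrightarrow> C \<subseteq> D"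
    if C: "C \<in> finite_subsets X" and D: "D \<in> finite_subsets X" for C D
  proof
    assume "f C \<subseteq> f D"
    moreover have "f C \<in> finite_subsets Y" "f D \<in> finite_subsets Y"
      using bij C D by (auto simp: bij_betw_def)
    ultimately have "g (f C) \<subseteq> g (f D)"
      using mono_onD [OF g_mono] C by blast
    then show "C \<subseteq> D" using gf C D by simp
  qed (use mono_onD [OF f_mono] C D in blast)
  ultimately show ?R by blast
next
  assume R: ?R
  let ?F = "finite_subsets X" and ?g = "inv_into (finite_subsets X) f"
  have g: "?g C \<in> ?F" "f (?g C) = C" if "C \<in> finite_subsets Y" for C
    using R that by (auto simp: bij_betw_def inv_into_into f_inv_into_f)
  have gf: "?g (f C) = C" if "C \<in> ?F" for C
    using R that by (auto simp: bij_betw_def)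
  have f_maps: "f \<in> ?F \<rightarrow> finite_subsets Y"
    using R by (auto simp: bij_betw_def)
  have f_mono: "mono_on ?F f"
    using R by (auto intro!: mono_onI)
  have g_mono: "mono_on (finite_subsets Y) ?g"
  proof (rule mono_onI)
    fix C D assume "C \<in> finite_subsets Y" "D \<in> finite_subsets Y" "C \<subseteq> D"
    then have "f (?g C) \<subseteq> f (?g D)" "?g C \<in> ?F" "?g D \<in> ?F"
      using g by auto
    then show "?g C \<subseteq> ?g D" using R by blast
  qed
  have "homeomorphic_maps (finite_hyperspace X) (finite_hyperspace Y) f ?g"
    using f_maps f_mono g_mono g gf
    by (auto simp: homeomorphic_maps_def continuous_map_finite_hyperspace_iff
        topspace_eq_finite_subsets)
  then show ?L by (auto simp: homeomorphic_map_maps)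
qed

section \<open>Recovering the bijection of points\<close>

text \<open>If \<open>y \<in> f {x}\<close>, then \<open>{y}\<close> is the value of \<open>f\<close> at some set below \<open>{x}\<close>, which can only be
  \<open>{x}\<close> itself; so \<open>f {x}\<close> is a singleton. After that, \<open>x \<in> C\<close> is the order relation
  \<open>{x} \<subseteq> C\<close>, which \<open>f\<close> preserves and reflects.\<close>

lemma order_iso_imp_image:
  fixes f :: "'a set \<Rightarrow> 'b set"
  assumes bij: "bij_betw f (finite_subsets X) (finite_subsets Y)"
    and ord: "\<And>C D. C \<in> finite_subsets X \<Longrightarrow> D \<in> finite_subsets X \<Longrightarrow> f C \<subseteq> f D \<longleftrightarrow> C \<subseteq> D"
  obtains \<gamma> where "bij_betw \<gamma> X Y" "\<And>C. C \<in> finite_subsets X \<Longrightarrow> f C = \<gamma> ` C"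
proof -
  have f_in: "f C \<in> finite_subsets Y" if "C \<in> finite_subsets X" for C
    using bij that by (auto simp: bij_betw_def)
  have below_singleton: "C = {x}" if "C \<in> finite_subsets X" "C \<subseteq> {x}" for C x
    using that by (auto simp: finite_subsets_def)
  have singleton_value: "\<exists>C\<in>finite_subsets X. f C = {y}" if "y \<in> Y" for y
  proof -
    have "{y} \<in> f ` finite_subsets X" using bij that by (simp add: bij_betw_def)
    then show ?thesis by (auto simp: image_iff)
  qed
  have "\<exists>y. f {x} = {y}" if x: "x \<in> X" for x
  proof -
    have fx: "f {x} \<in> finite_subsets Y" using f_in x by simp
    then obtain y where y: "y \<in> f {x}" "y \<in> Y" by (auto simp: finite_subsets_def)
    then obtain C where C: "C \<in> finite_subsets X" "f C = {y}"
      using singleton_value by blast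
    then have "C \<subseteq> {x}" using ord [of C "{x}"] x y by simp
    then show ?thesis using below_singleton C by blast
  qed
  then obtain \<gamma> where \<gamma>: "f {x} = {\<gamma> x}" if "x \<in> X" for x by metis
  have mem: "\<gamma> x \<in> f C \<longleftrightarrow> x \<in> C" if "x \<in> X" "C \<in> finite_subsets X" for x C
    using ord [of "{x}" C] that \<gamma> by simp
  have maps: "\<gamma> x \<in> Y" if "x \<in> X" for x
    using f_in [of "{x}"] that \<gamma> by simp
  have inj: "inj_on \<gamma> X"
  proof (rule inj_onI)
    fix x y assume "x \<in> X" "y \<in> X" "\<gamma> x = \<gamma> y"
    then show "x = y" using mem [of x "{y}"] \<gamma> by simp
  qed
  have surj: "Y \<subseteq> \<gamma> ` X"
  proof
    fix y assume "y \<in> Y"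
    then obtain C where C: "C \<in> finite_subsets X" "f C = {y}"
      using singleton_value by blast
    then obtain x where "x \<in> C" "x \<in> X" by (auto simp: finite_subsets_def)
    then show "y \<in> \<gamma> ` X" using mem C by force
  qed
  have "f C = \<gamma> ` C" if C: "C \<in> finite_subsets X" for C
  proof -
    have "C \<subseteq> X" "f C \<subseteq> Y" using C f_in by (auto simp: finite_subsets_def)
    then show ?thesis using mem C surj by blast
  qed
  moreover have "bij_betw \<gamma> X Y" using inj surj maps by (auto simp: bij_betw_def)
  ultimately show thesis using that by blast
qed

theorem homeomorphic_map_finite_hyperspace_iff_image:
  "homeomorphic_map (finite_hyperspace X) (finite_hyperspace Y) f \<longleftrightarrow>
    (\<exists>\<gamma>. bij_betw \<gamma> X Y \<and> (\<forall>C\<in>finite_subsets X. f C = \<gamma> ` C))"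
    (is "?L \<longleftrightarrow> ?R")
proof
  assume ?L
  then show ?R
    unfolding homeomorphic_map_finite_hyperspace_iff_order by (metis order_iso_imp_image)
next
  assume ?R
  then obtain \<gamma> where \<gamma>: "bij_betw \<gamma> X Y" "\<And>C. C \<in> finite_subsets X \<Longrightarrow> f C = \<gamma> ` C"
    by blast
  have "bij_betw f (finite_subsets X) (finite_subsets Y)"
    using bij_betw_image_finite_subsets [OF \<gamma>(1)] bij_betw_cong [of "finite_subsets X" f] \<gamma>(2)
    by blast
  moreover have "f C \<subseteq> f D \<longleftrightarrow> C \<subseteq> D" if "C \<in> finite_subsets X" "D \<in> finite_subsets X" for C D
  proof -
    have "C \<subseteq> X" "D \<subseteq> X" using that by (auto simp: finite_subsets_def)
    then have "\<gamma> ` C \<subseteq> \<gamma> ` D \<longleftrightarrow> C \<subseteq> D"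
      using \<gamma>(1) unfolding bij_betw_def inj_on_def by blast
    then show ?thesis using \<gamma>(2) that by simp
  qed
  ultimately show ?L
    unfolding homeomorphic_map_finite_hyperspace_iff_order by blast
qed

section \<open>The homeomorphism group\<close>

text \<open>This is \<open>2\<^sup>\<gamma>\<close>, made extensional so that it can be an element of the homeomorphism
  group.\<close>

definition image_map :: "'a set \<Rightarrow> ('a \<Rightarrow> 'b) \<Rightarrow> 'a set \<Rightarrow> 'b set"
  where "image_map X \<gamma> = (\<lambda>C\<in>finite_subsets X. \<gamma> ` C)"

lemma carrier_HomeoGroup_finite_hyperspace:
  "carrier (HomeoGroup (finite_hyperspace X)) =
    {f \<in> extensional (finite_subsets X).
      homeomorphic_map (finite_hyperspace X) (finite_hyperspace X) f}"
  by (simp add: HomeoGroup_def topspace_eq_finite_subsets)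

lemma image_map_in_HomeoGroup:
  assumes "\<gamma> \<in> Bij X"
  shows "image_map X \<gamma> \<in> carrier (HomeoGroup (finite_hyperspace X))"
  unfolding carrier_HomeoGroup_finite_hyperspace homeomorphic_map_finite_hyperspace_iff_image
  using assms by (auto simp: image_map_def Bij_def)

lemma image_map_compose:
  assumes "\<delta> \<in> Bij X"
  shows "image_map X (compose X \<gamma> \<delta>) =
    compose (finite_subsets X) (image_map X \<gamma>) (image_map X \<delta>)"
proof
  fix C
  have "\<delta> ` C \<in> finite_subsets X" if "C \<in> finite_subsets X"
    using assms that by (auto simp: Bij_def bij_betw_def finite_subsets_def)
  moreover have "compose X \<gamma> \<delta> ` C = \<gamma> ` \<delta> ` C" if "C \<in> finite_subsets X"
    using that by (auto simp: compose_def finite_subsets_def image_iff subset_iff)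
  ultimately show "image_map X (compose X \<gamma> \<delta>) C =
      compose (finite_subsets X) (image_map X \<gamma>) (image_map X \<delta>) C"
    by (simp add: image_map_def compose_def)
qed

text \<open>The values of \<open>\<gamma>\<close> are read off from \<open>2\<^sup>\<gamma>\<close> at the singletons.\<close>

lemma inj_on_image_map: "inj_on (image_map X) (extensional X)"
proof (rule inj_onI)
  fix \<gamma> \<delta> assume ext: "\<gamma> \<in> extensional X" "\<delta> \<in> extensional X"
    and eq: "image_map X \<gamma> = image_map X \<delta>"
  have "\<gamma> x = \<delta> x" if "x \<in> X" for x
    using fun_cong [OF eq, of "{x}"] that by (simp add: image_map_def)
  then show "\<gamma> = \<delta>" by (rule extensionalityI [OF ext])
qed

text \<open>Surjectivity is the theorem on homeomorphisms; the bijection it provides is arbitrary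
  outside \<open>X\<close> and has to be restricted to \<open>X\<close> to lie in the permutation group.\<close>

lemma image_map_iso:
  "image_map X \<in> iso (BijGroup X) (HomeoGroup (finite_hyperspace X))"
proof (rule isoI)
  show "image_map X \<in> hom (BijGroup X) (HomeoGroup (finite_hyperspace X))"
  proof (rule homI)
    fix \<gamma> \<delta> assume "\<gamma> \<in> carrier (BijGroup X)" "\<delta> \<in> carrier (BijGroup X)"
    then have Bij: "\<gamma> \<in> Bij X" "\<delta> \<in> Bij X" by (simp_all add: BijGroup_def)
    then have "image_map X \<gamma> \<in> Bij (finite_subsets X)" "image_map X \<delta> \<in> Bij (finite_subsets X)"
      using image_map_in_HomeoGroup [of _ X]
      by (auto simp: carrier_HomeoGroup_finite_hyperspace Bij_def
          homeomorphic_map_finite_hyperspace_iff_order)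
    then show "image_map X (\<gamma> \<otimes>\<^bsub>BijGroup X\<^esub> \<delta>) =
        image_map X \<gamma> \<otimes>\<^bsub>HomeoGroup (finite_hyperspace X)\<^esub> image_map X \<delta>"
      using Bij
      by (simp add: HomeoGroup_def BijGroup_def topspace_eq_finite_subsets image_map_compose)
  qed (simp add: image_map_in_HomeoGroup BijGroup_def)
  show "bij_betw (image_map X) (carrier (BijGroup X))
      (carrier (HomeoGroup (finite_hyperspace X)))"
  proof (rule bij_betw_imageI)
    show "inj_on (image_map X) (carrier (BijGroup X))"
      by (rule inj_on_subset [OF inj_on_image_map]) (auto simp: BijGroup_def Bij_def)
    show "image_map X ` carrier (BijGroup X) = carrier (HomeoGroup (finite_hyperspace X))"
    proof (intro equalityI subsetI)
      fix f assume f: "f \<in> carrier (HomeoGroup (finite_hyperspace X))"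
      then obtain \<gamma> where \<gamma>: "bij_betw \<gamma> X X" "\<And>C. C \<in> finite_subsets X \<Longrightarrow> f C = \<gamma> ` C"
        unfolding carrier_HomeoGroup_finite_hyperspace
          homeomorphic_map_finite_hyperspace_iff_image by blast
      have "f = image_map X (restrict \<gamma> X)"
      proof (rule extensionalityI)
        show "f \<in> extensional (finite_subsets X)"
          using f by (simp add: carrier_HomeoGroup_finite_hyperspace)
        show "image_map X (restrict \<gamma> X) \<in> extensional (finite_subsets X)"
          by (simp add: image_map_def)
        show "f C = image_map X (restrict \<gamma> X) C" if "C \<in> finite_subsets X" for C
          using \<gamma>(2) that by (auto simp: image_map_def finite_subsets_def image_iff subset_iff)
      qed
      moreover have "restrict \<gamma> X \<in> carrier (BijGroup X)"
        using \<gamma>(1) by (simp add: BijGroup_def Bij_def)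
      ultimately show "f \<in> image_map X ` carrier (BijGroup X)" by blast
    qed (auto simp: image_map_in_HomeoGroup BijGroup_def)
  qed
qed

theorem proposition5:
  fixes X :: "'a set"
  shows "(\<forall>f \<in> topspace (finite_hyperspace X) \<rightarrow> topspace (finite_hyperspace X).
            homeomorphic_map (finite_hyperspace X) (finite_hyperspace X) f \<longleftrightarrow>
            (\<exists>\<gamma>. bij_betw \<gamma> X X \<and> (\<forall>C \<in> topspace (finite_hyperspace X). f C = \<gamma> ` C)))
         \<and> HomeoGroup (finite_hyperspace X) \<cong> BijGroup X"
proof
  show "HomeoGroup (finite_hyperspace X) \<cong> BijGroup X"
    using image_map_iso [of X] group.iso_sym [OF group_BijGroup [of X]]
    by (auto simp: is_iso_def)
qed (simp add: homeomorphic_map_finite_hyperspace_iff_image topspace_eq_finite_subsets)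

end
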